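(* If $P \subseteq \mathbb{R}^2$ is a nonempty open set, then $\operatorname{opx}(n, P) = \Theta(n^2)$ (as $n \to \infty$ over positive reals), where the constant in the lower bound depends on $P$.
   Context: Containment for subsets of the plane: for $P, S \subseteq \mathbb{R}^2$, let $X_P, Y_P$ be the sets of $x$-coordinates and $y$-coordinates of points of $P$, and $X_S, Y_S$ likewise for $S$. $S$ contains $P$ if there exist functions $f_X: X_P \to X_S$ and $f_Y: Y_P \to Y_S$ such that (1) $\frac{f_X(x_0)-f_X(x_1)}{x_0-x_1} \ge 1$ for all $x_0 > x_1$ in $X_P$; (2) $\frac{f_Y(y_0)-f_Y(y_1)}{y_0-y_1} \ge 1$ for all $y_0 > y_1$ in $Y_P$; (3) $(f_X(x), f_Y(y)) \in S$ for all $(x,y) \in P$. Otherwise $S$ is $P$-free. For real $n > 0$, $\operatorname{opx}(n,P)$ is the supremum of the Lebesgue measure $\mu_2(S)$ over all open (in $\mathbb{R}^2$) $P$-free subsets $S \subseteq [0,n]^2$. $f(n) = \Theta(g(n))$ means there are constants $C_1, C_2 > 0$ with $C_1 g(n) \le f(n) \le C_2 g(n)$ for all sufficiently large $n$. *)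

theory Defs
  imports "HOL-Analysis.Analysis"
begin

text \<open>The maps are total functions on the reals; only their values on the coordinate
  projections of \<open>P\<close> matter.\<close>

definition contains_set :: "(real \<times> real) set \<Rightarrow> (real \<times> real) set \<Rightarrow> bool" where
  "contains_set S P \<longleftrightarrow>
    (\<exists>fX fY. fX \<in> fst ` P \<rightarrow> fst ` S \<and> fY \<in> snd ` P \<rightarrow> snd ` S \<and>
      (\<forall>x0\<in>fst ` P. \<forall>x1\<in>fst ` P. x0 > x1 \<longrightarrow> (fX x0 - fX x1) / (x0 - x1) \<ge> 1) \<and>
      (\<forall>y0\<in>snd ` P. \<forall>y1\<in>snd ` P. y0 > y1 \<longrightarrow> (fY y0 - fY y1) / (y0 - y1) \<ge> 1) \<and>
      (\<forall>(x, y)\<in>P. (fX x, fY y) \<in> S))"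

abbreviation free_of :: "(real \<times> real) set \<Rightarrow> (real \<times> real) set \<Rightarrow> bool" where
  "free_of P S \<equiv> \<not> contains_set S P"

text \<open>For \<open>n > 0\<close> and nonempty \<open>P\<close> the supremum below is over a nonempty set (the empty \<open>S\<close> is
  \<open>P\<close>-free) bounded above by \<open>n\<^sup>2\<close>, so the supremum in the reals is the intended one.\<close>

definition opx :: "real \<Rightarrow> (real \<times> real) set \<Rightarrow> real" where
  "opx n P = Sup {measure lebesgue S | S. open S \<and> S \<subseteq> {0..n} \<times> {0..n} \<and> free_of P S}"

end

theory Submission
  imports Defs "HOL-Real_Asymp.Real_Asymp"
begin

text \<open>Divide \<open>[0,n]\<^sup>2\<close> into square cells of side \<open>s = e / t\<close>, where \<open>P\<close> contains a product of
  two intervals of radius \<open>e\<close>, and let \<open>S\<close> be a union of open cells. Expanding maps send \<open>t\<close> points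
  with spacing \<open>s\<close> into \<open>t\<close> different columns (respectively rows), so if \<open>S\<close> contains \<open>P\<close> then
  the bipartite graph of chosen cells contains a complete bipartite graph \<open>K\<^sub>t\<^sub>,\<^sub>t\<close>. If the
  number \<open>N\<close> of columns satisfies \<open>4 N\<^sup>2 \<le> 2\<^sup>t\<close>, then by the counting argument of Erdos there is a
  bipartite graph such that neither it nor its complement contains \<open>K\<^sub>t\<^sub>,\<^sub>t\<close>, and one of the two has at
  least half of all edges. As \<open>N\<close> is about \<open>n t / e\<close>, the choice \<open>t = \<lceil>n\<rceil>\<close> is more than enough.\<close>

section \<open>Counting: dense bipartite graphs without large bicliques\<close>

lemma card_supersets_within:
  assumes "finite U" "K \<subseteq> U"
  shows "card {G. K \<subseteq> G \<and> G \<subseteq> U} = 2 ^ (card U - card K)"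
proof -
  have "{G. K \<subseteq> G \<and> G \<subseteq> U} = (\<union>) K ` Pow (U - K)"
  proof (intro equalityI subsetI)
    fix G assume "G \<in> {G. K \<subseteq> G \<and> G \<subseteq> U}"
    then show "G \<in> (\<union>) K ` Pow (U - K)"
      by (intro image_eqI[of _ _ "G - K"]) auto
  qed (use assms(2) in auto)
  moreover have "inj_on ((\<union>) K) (Pow (U - K))"
    by (auto simp: inj_on_def)
  ultimately show ?thesis
    using assms by (simp add: card_image card_Pow card_Diff_subset finite_subset)
qed

lemma choose_le_power: "n choose k \<le> n ^ k"
  by (cases "k \<le> n") (auto simp: binomial_le_pow binomial_eq_0)

text \<open>\<open>G\<close> is the edge set of a bipartite graph on two copies of
  \<open>{..<N}\<close>. A union bound over at most \<open>N ^ (2 * t)\<close> pairs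
  \<open>(A, B)\<close>, each excluding at most \<open>2 * 2 ^ (N\<^sup>2 - t\<^sup>2)\<close>
  graphs, leaves some graph \<open>H\<close>. Since graphs are excluded symmetrically under
  complement, the denser of \<open>H\<close> and its complement can be taken.\<close>

lemma exists_dense_biclique_free:
  fixes N t :: nat
  assumes t: "t > 0" and N: "4 * N\<^sup>2 \<le> 2 ^ t"
  obtains G where "G \<subseteq> {..<N} \<times> {..<N}" "N\<^sup>2 \<le> 2 * card G"
    "\<And>A B. card A = t \<Longrightarrow> card B = t \<Longrightarrow> \<not> A \<times> B \<subseteq> G"
proof -
  define U where "U = {..<N} \<times> {..<N}"
  define T where "T = {A. A \<subseteq> {..<N} \<and> card A = t}"
  \<comment> \<open>The first set holds the graphs containing the biclique on \<open>A\<close> and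
    \<open>B\<close>, the second those whose complement contains it.\<close>
  define F where "F = (\<lambda>(A, B). {G. A \<times> B \<subseteq> G \<and> G \<subseteq> U} \<union> {G. G \<subseteq> U \<and> A \<times> B \<inter> G = {}})"
  define bad where "bad = (\<Union>p\<in>T \<times> T. F p)"
  have finU: "finite U" and cardU: "card U = N\<^sup>2"
    by (auto simp: U_def power2_eq_square)
  have finT: "finite T"
    by (auto simp: T_def)
  have cardT: "card T \<le> N ^ t"
    unfolding T_def using n_subsets[of "{..<N}" t] choose_le_power[of N t] by simp
  have cardF: "card (F p) * 2 ^ t\<^sup>2 \<le> 2 * 2 ^ N\<^sup>2" if "p \<in> T \<times> T" for p
  proof -
    obtain A B where p: "p = (A, B)" and AB: "A \<in> T" "B \<in> T"
      using \<open>p \<in> T \<times> T\<close> by auto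
    have sub: "A \<times> B \<subseteq> U" and K: "card (A \<times> B) = t\<^sup>2"
      using AB by (auto simp: T_def U_def card_cartesian_product power2_eq_square)
    \<comment> \<open>This keeps the natural subtraction in the exponents below from
      truncating.\<close>
    have le: "t\<^sup>2 \<le> N\<^sup>2"
      using card_mono[OF finU sub] K cardU by simp
    have "{G. G \<subseteq> U \<and> A \<times> B \<inter> G = {}} = Pow (U - A \<times> B)"
      by auto
    then have "card {G. G \<subseteq> U \<and> A \<times> B \<inter> G = {}} = 2 ^ (N\<^sup>2 - t\<^sup>2)"
      using finU sub K cardU by (simp add: card_Pow card_Diff_subset finite_subset)
    moreover have "card {G. A \<times> B \<subseteq> G \<and> G \<subseteq> U} = 2 ^ (N\<^sup>2 - t\<^sup>2)"
      using card_supersets_within[OF finU sub] K cardU by simp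
    ultimately have "card (F p) \<le> 2 * 2 ^ (N\<^sup>2 - t\<^sup>2)"
      unfolding p F_def
      using card_Un_le[of "{G. A \<times> B \<subseteq> G \<and> G \<subseteq> U}" "{G. G \<subseteq> U \<and> A \<times> B \<inter> G = {}}"] by simp
    then have "card (F p) * 2 ^ t\<^sup>2 \<le> 2 * 2 ^ (N\<^sup>2 - t\<^sup>2) * 2 ^ t\<^sup>2"
      by simp
    also have "\<dots> = 2 * 2 ^ N\<^sup>2"
      using le by (simp flip: power_add)
    finally show ?thesis .
  qed
  have "card bad * 2 ^ t\<^sup>2 \<le> (\<Sum>p\<in>T \<times> T. card (F p)) * 2 ^ t\<^sup>2"
    unfolding bad_def using finT by (intro mult_right_mono card_UN_le) auto
  also have "\<dots> \<le> (\<Sum>p\<in>T \<times> T. 2 * 2 ^ N\<^sup>2)"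
    unfolding sum_distrib_right by (intro sum_mono cardF)
  also have "\<dots> = (card T * card T) * (2 * 2 ^ N\<^sup>2)"
    by (simp add: card_cartesian_product)
  also have "\<dots> \<le> (N ^ t * N ^ t) * (2 * 2 ^ N\<^sup>2)"
    by (intro mult_right_mono mult_mono cardT) auto
  finally have bound: "card bad * 2 ^ t\<^sup>2 \<le> 2 * (N\<^sup>2) ^ t * 2 ^ N\<^sup>2"
    by (simp add: power2_eq_square power_mult_distrib mult_ac)
  have "card bad < 2 ^ N\<^sup>2"
  \<comment> \<open>The strict inequality between \<open>t\<close>-th powers below would read
    \<open>0 < 0\<close> for \<open>N = 0\<close>.\<close>
  proof (cases "N = 0")
    case True
    then have "T = {}"
      using t by (auto simp: T_def)
    then show ?thesis
      by (simp add: bad_def)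
  next
    case False
    \<comment> \<open>Raising \<open>4 * N\<^sup>2 \<le> 2 ^ t\<close> to the power \<open>t\<close>
      bounds \<open>4 ^ t * (N\<^sup>2) ^ t\<close> by \<open>2 ^ t\<^sup>2\<close>; the factor
      \<open>4 ^ t\<close> absorbs the \<open>2\<close> in \<open>bound\<close>, which comes from
      treating a graph and its complement together.\<close>
    have "(2::nat) < 4 ^ t"
      using t self_le_power[of "4::nat" t] by simp
    then have "2 * (N\<^sup>2) ^ t < (4 * N\<^sup>2) ^ t"
      using False by (simp add: power_mult_distrib)
    also have "\<dots> \<le> (2 ^ t) ^ t"
      by (intro power_mono N) auto
    finally have "2 * (N\<^sup>2) ^ t < 2 ^ t\<^sup>2"
      by (simp add: power2_eq_square power_mult)
    then have "card bad * 2 ^ t\<^sup>2 < 2 ^ t\<^sup>2 * 2 ^ N\<^sup>2"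
      using bound by (meson le_less_trans mult_less_mono1 zero_less_numeral zero_less_power)
    then show ?thesis
      by simp
  qed
  moreover have "bad \<subseteq> Pow U"
    by (auto simp: bad_def F_def)
  ultimately obtain H where H: "H \<subseteq> U" "H \<notin> bad"
    using finU cardU by (metis Pow_iff card_Pow less_irrefl subsetI subset_antisym)
  have no_biclique: "\<not> A \<times> B \<subseteq> G"
    if "G = H \<or> G = U - H" and A: "card A = t" and B: "card B = t" for G A B
  proof
    assume sub: "A \<times> B \<subseteq> G"
    \<comment> \<open>Nonempty factors let the inclusion of \<open>A \<times> B\<close> in
      \<open>U\<close> pass to each factor, so arbitrary \<open>A\<close> and \<open>B\<close>
      reduce to members of \<open>T\<close>.\<close>
    have "A \<noteq> {}" "B \<noteq> {}"
      using A B t by auto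
    then have "A \<subseteq> {..<N}" "B \<subseteq> {..<N}"
      using sub that(1) H(1) by (auto simp: U_def)
    then have "(A, B) \<in> T \<times> T"
      using A B by (auto simp: T_def)
    moreover have "H \<in> F (A, B)"
      using sub that(1) H(1) by (auto simp: F_def)
    ultimately show False
      using H(2) by (auto simp: bad_def)
  qed
  have "card H + card (U - H) = N\<^sup>2"
    using H(1) finU cardU by (metis card_Diff_subset card_mono finite_subset le_add_diff_inverse)
  then consider "N\<^sup>2 \<le> 2 * card H" | "N\<^sup>2 \<le> 2 * card (U - H)"
    by linarith
  then show thesis
  proof cases
    case 1
    then show thesis
      using that[of H] H(1) no_biclique by (auto simp: U_def)
  next
    case 2
    then show thesis
      using that[of "U - H"] no_biclique by (auto simp: U_def)
  qed
qed

section \<open>Grid cells, their unions and measures\<close>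

definition cell :: "real \<Rightarrow> nat \<Rightarrow> real set" where
  "cell s i = {real i * s<..<real (Suc i) * s}"

text \<open>An edge \<open>(i, j)\<close> selects the square in column \<open>i\<close> and row
  \<open>j\<close>. Cells are open so that the union is open; for \<open>s > 0\<close> distinct
  cells are disjoint, so its measure counts edges.\<close>

definition cell_union :: "real \<Rightarrow> (nat \<times> nat) set \<Rightarrow> (real \<times> real) set" where
  "cell_union s G = (\<Union>(i, j)\<in>G. cell s i \<times> cell s j)"

lemma cell_unique:
  assumes "s > 0" "x \<in> cell s i" "x \<in> cell s j"
  shows "i = j"
proof -
  have "real i * s < real (Suc j) * s" "real j * s < real (Suc i) * s"
    using assms(2,3) unfolding cell_def by auto
  then show ?thesis
    using assms(1) by (simp del: of_nat_Suc)
qed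

lemma cell_subset:
  assumes "s > 0" "i < N" "real N * s \<le> n"
  shows "cell s i \<subseteq> {0..n}"
proof
  fix x assume "x \<in> cell s i"
  moreover have "real (Suc i) * s \<le> real N * s" "0 \<le> real i * s"
    using assms by (auto intro!: mult_right_mono simp del: of_nat_Suc)
  ultimately show "x \<in> {0..n}"
    using assms(3) unfolding cell_def by auto
qed

lemma open_cell_union: "open (cell_union s G)"
  unfolding cell_union_def cell_def by (auto intro!: open_UN open_Times)

lemma measure_cell_product:
  assumes "s > 0"
  shows "cell s i \<times> cell s j \<in> lmeasurable" "measure lebesgue (cell s i \<times> cell s j) = s\<^sup>2"
proof -
  have eq: "cell s i \<times> cell s j = box (real i * s, real j * s) (real (Suc i) * s, real (Suc j) * s)"
    unfolding cell_def by (auto simp: mem_box Basis_prod_def)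
  show "cell s i \<times> cell s j \<in> lmeasurable"
    unfolding eq by (rule lmeasurable_box)
  show "measure lebesgue (cell s i \<times> cell s j) = s\<^sup>2"
    unfolding eq using assms
    by (simp add: content_Pair measure_lborel_box_eq Basis_prod_def power2_eq_square algebra_simps)
qed

lemma measure_cell_union:
  assumes "s > 0" "finite G"
  shows "measure lebesgue (cell_union s G) = real (card G) * s\<^sup>2"
proof -
  define C where "C = (\<lambda>p. cell s (fst p) \<times> cell s (snd p))"
  have U: "cell_union s G = (\<Union>p\<in>G. C p)"
    by (auto simp: cell_union_def C_def)
  have meas: "C p \<in> lmeasurable" for p
    unfolding C_def using measure_cell_product(1)[OF assms(1)] .
  have "disjoint_family_on C G"
    unfolding disjoint_family_on_def C_def using cell_unique[OF assms(1)]
    by (fastforce simp: prod_eq_iff)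
  then have "measure lebesgue (\<Union>p\<in>G. C p) = (\<Sum>p\<in>G. measure lebesgue (C p))"
    using assms(2) fmeasurableD[OF meas] fmeasurableD2[OF meas, folded infinity_ennreal_def]
    by (intro measure_finite_Union) blast+
  then show ?thesis
    unfolding U using measure_cell_product(2)[OF assms(1)] by (simp add: C_def)
qed

section \<open>From containment to bicliques\<close>

lemma expanding_distinct_cells:
  fixes f :: "real \<Rightarrow> real" and x :: "nat \<Rightarrow> real" and c :: "nat \<Rightarrow> nat"
  assumes s: "s > 0"
    and spread: "\<And>k l. k < l \<Longrightarrow> l < t \<Longrightarrow> x l - x k \<ge> s"
    and expand: "\<And>k l. k < t \<Longrightarrow> l < t \<Longrightarrow> x l > x k \<Longrightarrow> (f (x l) - f (x k)) / (x l - x k) \<ge> 1"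
    and c: "\<And>k. k < t \<Longrightarrow> f (x k) \<in> cell s (c k)"
  shows "card (c ` {..<t}) = t"
proof -
  have "c k \<noteq> c l" if "k < l" "l < t" for k l
  proof
    assume eq: "c k = c l"
    have "x l - x k \<ge> s"
      using spread that .
    with s have "x l - x k > 0"
      by simp
    then have "f (x l) - f (x k) \<ge> x l - x k"
      using expand[of k l] that by (simp add: le_divide_eq)
    \<comment> \<open>Two points of one open interval of length \<open>s\<close> are less than
      \<open>s\<close> apart.\<close>
    moreover have "f (x l) - f (x k) < s"
      using c[of k] c[of l] that eq unfolding cell_def by (auto simp: algebra_simps)
    ultimately show False
      using \<open>x l - x k \<ge> s\<close> by simp
  qed
  then have "inj_on c {..<t}"
    by (intro linorder_inj_onI) auto
  then show ?thesis
    by (simp add: card_image)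
qed

text \<open>A containment maps a \<open>t\<close> by \<open>t\<close> grid of points of
  \<open>P\<close> with spacing \<open>s\<close> into cells occupying \<open>t\<close> distinct
  columns and \<open>t\<close> distinct rows, and all their crossings are edges of \<open>G\<close>.
  The choice \<open>e = real t * s\<close> keeps the offsets \<open>k * s\<close> with
  \<open>k < t\<close> below the radius.\<close>

lemma cell_union_free:
  assumes s: "s > 0" and e: "e = real t * s"
    and P: "ball a e \<times> ball b e \<subseteq> P"
    and G: "\<And>A B. card A = t \<Longrightarrow> card B = t \<Longrightarrow> \<not> A \<times> B \<subseteq> G"
  shows "free_of P (cell_union s G)"
proof
  assume "contains_set (cell_union s G) P"
  then obtain f g where
      f: "\<And>x0 x1. x0 \<in> fst ` P \<Longrightarrow> x1 \<in> fst ` P \<Longrightarrow> x0 > x1 \<Longrightarrow> (f x0 - f x1) / (x0 - x1) \<ge> 1"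
    and g: "\<And>y0 y1. y0 \<in> snd ` P \<Longrightarrow> y1 \<in> snd ` P \<Longrightarrow> y0 > y1 \<Longrightarrow> (g y0 - g y1) / (y0 - y1) \<ge> 1"
    and fg: "\<And>x y. (x, y) \<in> P \<Longrightarrow> (f x, g y) \<in> cell_union s G"
    unfolding contains_set_def by (elim exE conjE) (rule that; fast)
  define x where "x = (\<lambda>k::nat. a + real k * s)"
  define y where "y = (\<lambda>k::nat. b + real k * s)"
  have mem: "(x k, y l) \<in> P" if "k < t" "l < t" for k l
  proof -
    have "0 \<le> real m * s" "real m * s < e" if "m < t" for m
      using that s by (simp_all add: e)
    then have "x k \<in> ball a e" "y l \<in> ball b e"
      using that by (simp_all add: x_def y_def dist_real_def)
    then show ?thesis
      using P by auto
  qed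
  have xP: "x k \<in> fst ` P" and yP: "y k \<in> snd ` P" if "k < t" for k
    using mem[OF that that] by force+
  have cells: "\<exists>i j. (i, j) \<in> G \<and> f (x k) \<in> cell s i \<and> g (y l) \<in> cell s j"
    if "k < t" "l < t" for k l
    using fg[OF mem[OF that]] by (auto simp: cell_union_def)
  have "\<forall>k<t. \<exists>i. f (x k) \<in> cell s i" "\<forall>k<t. \<exists>i. g (y k) \<in> cell s i"
    using cells by blast+
  then obtain c d where c: "\<And>k. k < t \<Longrightarrow> f (x k) \<in> cell s (c k)"
    and d: "\<And>k. k < t \<Longrightarrow> g (y k) \<in> cell s (d k)"
    by metis
  have spread: "x l - x k \<ge> s" "y l - y k \<ge> s" if "k < l" for k l
  proof -
    have "s * 1 \<le> s * (real l - real k)"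
      using that s by (intro mult_left_mono) auto
    then show "x l - x k \<ge> s" "y l - y k \<ge> s"
      by (simp_all add: x_def y_def algebra_simps)
  qed
  have "card (c ` {..<t}) = t"
    using spread(1) f[OF xP xP] c
    by (intro expanding_distinct_cells[OF s, of t x f c]) blast+
  moreover have "card (d ` {..<t}) = t"
    using spread(2) g[OF yP yP] d
    by (intro expanding_distinct_cells[OF s, of t y g d]) blast+
  moreover have "c ` {..<t} \<times> d ` {..<t} \<subseteq> G"
  proof
    fix p assume "p \<in> c ` {..<t} \<times> d ` {..<t}"
    then obtain k l where p: "p = (c k, d l)" and kl: "k < t" "l < t"
      by auto
    \<comment> \<open>The cell found for the pair \<open>(k, l)\<close> might depend on both
      indices; uniqueness of cells identifies it with column \<open>c k\<close> and row
      \<open>d l\<close>, which were chosen separately.\<close>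
    obtain i j where "(i, j) \<in> G" "f (x k) \<in> cell s i" "g (y l) \<in> cell s j"
      using cells[OF kl] by blast
    then show "p \<in> G"
      unfolding p using cell_unique[OF s c[OF kl(1)]] cell_unique[OF s d[OF kl(2)]] by blast
  qed
  ultimately show False
    using G by blast
qed

section \<open>Upper and lower bounds for \<open>opx\<close>\<close>

lemma measure_square_subset_le:
  fixes S :: "(real \<times> real) set"
  assumes "open S" "S \<subseteq> {0..n} \<times> {0..n}" "n \<ge> 0"
  shows "measure lebesgue S \<le> n\<^sup>2"
proof -
  have eq: "{0..n} \<times> {0..n} = cbox (0, 0) (n, n)"
    by (auto simp: cbox_Pair_eq)
  have "measure lebesgue S \<le> measure lebesgue (cbox (0, 0) (n, n))"
    using assms unfolding eq
    by (intro measure_mono_fmeasurable) auto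
  also have "\<dots> = n\<^sup>2"
    using assms(3) by (simp add: content_Pair power2_eq_square)
  finally show ?thesis .
qed

lemma opx_upper:
  assumes "n \<ge> 0" "P \<noteq> {}"
  shows "opx n P \<le> n\<^sup>2"
  unfolding opx_def
proof (rule cSup_least)
  have "free_of P {}"
    using assms(2) by (auto simp: contains_set_def)
  then show "{measure lebesgue S |S. open S \<and> S \<subseteq> {0..n} \<times> {0..n} \<and> free_of P S} \<noteq> {}"
    by (auto intro!: exI[of _ "{}"])
qed (use assms measure_square_subset_le in auto)

lemma opx_lower:
  assumes "n \<ge> 0" "open S" "S \<subseteq> {0..n} \<times> {0..n}" "free_of P S"
  shows "measure lebesgue S \<le> opx n P"
  unfolding opx_def
proof (rule cSup_upper)
  show "bdd_above {measure lebesgue S |S. open S \<and> S \<subseteq> {0..n} \<times> {0..n} \<and> free_of P S}"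
    using measure_square_subset_le[OF _ _ assms(1)] by (intro bdd_aboveI[of _ "n\<^sup>2"]) auto
qed (use assms in blast)

text \<open>The constant \<open>1 / 8\<close> is a factor \<open>1 / 2\<close> for the density of
  \<open>G\<close> times \<open>1 / 4\<close> for rounding: the \<open>N\<close> whole cells that
  fit into \<open>[0, n]\<close> cover at least half of its length.\<close>

lemma opx_ge:
  fixes n e :: real and t :: nat
  assumes P: "ball a e \<times> ball b e \<subseteq> P" and e: "e > 0" and t: "t > 0" and n: "n \<ge> 0"
    and large: "1 \<le> n * t / e" "4 * (n * t / e)\<^sup>2 \<le> 2 ^ t"
  shows "n\<^sup>2 / 8 \<le> opx n P"
proof -
  define s where "s = e / t"
  have s: "s > 0" and est: "e = real t * s"
    using e t by (auto simp: s_def)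
  define N where "N = nat \<lfloor>n / s\<rfloor>"
  have ns: "n / s = n * t / e"
    by (simp add: s_def)
  have N: "real N \<le> n / s" "n / s \<le> real N + 1" "1 \<le> real N"
    using large(1) unfolding N_def ns[symmetric] by (linarith, linarith, simp add: le_nat_iff)
  have Ns: "real N * s \<le> n"
    using N(1) s by (simp add: pos_le_divide_eq)
  have "real (4 * N\<^sup>2) \<le> 4 * (n / s)\<^sup>2"
    using N(1) by (simp add: power_mono)
  also have "\<dots> \<le> real (2 ^ t)"
    using large(2) ns by simp
  finally have "4 * N\<^sup>2 \<le> 2 ^ t"
    by (simp only: of_nat_le_iff)
  then obtain G where G: "G \<subseteq> {..<N} \<times> {..<N}" "N\<^sup>2 \<le> 2 * card G"
      "\<And>A B. card A = t \<Longrightarrow> card B = t \<Longrightarrow> \<not> A \<times> B \<subseteq> G"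
    using exists_dense_biclique_free[OF t] by blast
  have "n \<le> 2 * (real N * s)"
  proof -
    \<comment> \<open>Rounding down loses at most \<open>1\<close>, and
      \<open>1 \<le> real N\<close>.\<close>
    have "n / s \<le> 2 * real N"
      using N by simp
    then show ?thesis
      using s by (simp add: pos_divide_le_eq mult_ac)
  qed
  then have "n\<^sup>2 \<le> (2 * (real N * s))\<^sup>2"
    using n by (rule power_mono)
  also have "\<dots> = 4 * (real (N\<^sup>2) * s\<^sup>2)"
    by (simp add: power_mult_distrib)
  also have "\<dots> \<le> 4 * (real (2 * card G) * s\<^sup>2)"
    by (intro mult_left_mono mult_right_mono) (use G(2) in \<open>simp_all only: of_nat_le_iff, auto\<close>)
  also have "\<dots> = 8 * measure lebesgue (cell_union s G)"
    using s G(1) by (simp add: measure_cell_union finite_subset)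
  also have "measure lebesgue (cell_union s G) \<le> opx n P"
  proof (rule opx_lower[OF n open_cell_union])
    show "cell_union s G \<subseteq> {0..n} \<times> {0..n}"
      using cell_subset[OF s _ Ns] G(1) unfolding cell_union_def by fast
    show "free_of P (cell_union s G)"
      using cell_union_free[OF s est P G(3)] .
  qed
  finally show ?thesis
    by simp
qed

theorem theorem4p4:
  "\<exists>C2>0. \<forall>P :: (real \<times> real) set. open P \<longrightarrow> P \<noteq> {} \<longrightarrow>
    (\<exists>C1>0. \<forall>\<^sub>F n :: real in at_top. C1 * n\<^sup>2 \<le> opx n P \<and> opx n P \<le> C2 * n\<^sup>2)"
proof -
  have "\<exists>C1>0. \<forall>\<^sub>F n :: real in at_top. C1 * n\<^sup>2 \<le> opx n P \<and> opx n P \<le> 1 * n\<^sup>2"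
    if "open P" "P \<noteq> {}" for P :: "(real \<times> real) set"
  proof -
    from that obtain a b A B where AB: "open A" "open B" "a \<in> A" "b \<in> B" "A \<times> B \<subseteq> P"
      by (metis ex_in_conv mem_Sigma_iff open_prod_elim surj_pair)
    obtain e1 e2 where e12: "e1 > 0" "ball a e1 \<subseteq> A" "e2 > 0" "ball b e2 \<subseteq> B"
      using AB by (meson openE)
    define e where "e = min e1 e2"
    have e: "e > 0"
      using e12 by (simp add: e_def)
    have "ball a e \<subseteq> A" "ball b e \<subseteq> B"
      using e12 by (auto simp: e_def)
    then have P: "ball a e \<times> ball b e \<subseteq> P"
      using AB(5) by blast
    \<comment> \<open>These conditions involve \<open>n\<close> alone; they imply the hypotheses of
      \<open>opx_ge\<close> because \<open>t\<close>, the ceiling of \<open>n\<close>, lies between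
      \<open>n\<close> and \<open>n + 1\<close>.\<close>
    have "\<forall>\<^sub>F n :: real in at_top. 1 \<le> n * n / e"
      using e by real_asymp
    moreover have "\<forall>\<^sub>F n :: real in at_top. 4 * (n * (n + 1) / e)\<^sup>2 \<le> 2 powr n"
      using e by real_asymp
    moreover have "\<forall>\<^sub>F n :: real in at_top. n > 0"
      by (rule eventually_gt_at_top)
    \<comment> \<open>The constant \<open>1 / 8\<close> serves every \<open>P\<close>; only the
      threshold for \<open>n\<close> depends on \<open>P\<close>, through \<open>e\<close>.\<close>
    ultimately have "\<forall>\<^sub>F n in at_top. 1 / 8 * n\<^sup>2 \<le> opx n P \<and> opx n P \<le> 1 * n\<^sup>2"
    proof eventually_elim
      case (elim n)
      define t where "t = nat \<lceil>n\<rceil>"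
      have t: "n \<le> real t" "real t \<le> n + 1" "t > 0"
        using elim(3) unfolding t_def by linarith+
      have "n * n / e \<le> n * t / e"
        using t e elim(3) by (intro divide_right_mono mult_left_mono) auto
      with elim(1) have "1 \<le> n * t / e"
        by linarith
      moreover have "4 * (n * t / e)\<^sup>2 \<le> 2 ^ t"
      proof -
        have "4 * (n * t / e)\<^sup>2 \<le> 4 * (n * (n + 1) / e)\<^sup>2"
          using t e elim(3)
          by (intro mult_left_mono power_mono divide_right_mono) auto
        also have "\<dots> \<le> 2 powr n"
          by (rule elim(2))
        also have "\<dots> \<le> 2 powr (real t)"
          using t(1) by simp
        finally show ?thesis
          by (simp add: powr_realpow)
      qed
      ultimately have "n\<^sup>2 / 8 \<le> opx n P"
        using opx_ge[OF P e t(3), of n] elim(3) by simp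
      then show ?case
        using opx_upper[OF _ \<open>P \<noteq> {}\<close>, of n] elim(3) by simp
    qed
    then show ?thesis
      by (intro exI[of _ "1/8"]) simp
  qed
  then show ?thesis
    by (intro exI[of _ "1::real"]) simp
qed

end
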